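(* Let $G$ be a topological group that is both amenable and skew-amenable, and let $G\curvearrowright X$ be a continuous isometric action on a metric space $X$. Assume that either $X$ has finite diameter or that $G$ has no non-trivial continuous homomorphisms to $\mathbb{R}$. Then there is a $G$-invariant linear contraction $$S:\mathfrak{Lip}(X)\to\mathfrak{Lip}(X/\!\!/G)$$ such that $(S\phi)(\overline{Gx})=\phi(x)$ (as an identity of functions of $x\in X$, modulo additive constants) whenever $\phi$ is constant on every orbit of $G\curvearrowright X$.
   Context: For a topological group $G$, $\mathsf{LUCB}(G)$ is the algebra of bounded functions $\phi:G\to\mathbb{R}$ such that $g\mapsto\phi(\,\cdot\,g)$ is continuous from $G$ to $\ell^\infty(G)$. A mean on $\mathsf{LUCB}(G)$ is a positive linear functional $\mathfrak m$ with $\|\mathfrak m\|=1$ and $\mathfrak m(\mathbf 1)=1$. $G$ is amenable if there is a mean with $\mathfrak m(\phi(\,\cdot\,g))=\mathfrak m(\phi)$ for all $g\in G$, $\phi\in\mathsf{LUCB}(G)$ (equivalently, every continuous affine action of $G$ on a non-empty compact convex subset of a locally convex space has a fixed point). $G$ is skew-amenable if there is a mean with $\mathfrak m(\phi(g^{-1}\,\cdot\,))=\mathfrak m(\phi)$ for all $g\in G$, $\phi\in\mathsf{LUCB}(G)$. For a metric space $X$, $\mathfrak{Lip}(X)=\mathsf{Lip}(X)/\{\text{constant functions}\}$, where $\mathsf{Lip}(X)$ is the space of real-valued Lipschitz functions; it is a Banach space under the norm $L(\phi)=\sup_{x\ne y}|\phi(x)-\phi(y)|/d(x,y)$. Elements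 of $\mathfrak{Lip}(X)$ are identified with representatives in $\mathsf{Lip}(X)$. For an isometric action $G\curvearrowright X$, $X/\!\!/G=\{\overline{Gx}\mid x\in X\}$ is the set of orbit closures with the Hausdorff distance, $d_H(\overline{Gx},\overline{Gy})=\inf_{h\in G}d(hx,y)$. A contraction is a linear operator of norm at most $1$; $S$ is $G$-invariant if $S(\phi(g^{-1}\,\cdot\,))=S\phi$ for all $g\in G$ and $\phi\in\mathfrak{Lip}(X)$. *)

theory Defs
  imports "HOL-Analysis.Analysis"
begin

section \<open>Amenability and skew-amenability\<close>

text \<open>
  Topological groups are types of class \<open>topological_group_add\<close>. Despite the additive notation
  this class does not assume commutativity: \<open>h + g\<close> is the product \<open>h g\<close>, \<open>- g\<close> is the
  inverse of \<open>g\<close> and \<open>0\<close> is the neutral element. No separation axiom is assumed.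
  The metric space \<open>funspace UNIV euclidean_metric\<close> is the space of bounded real functions
  with the supremum distance.
\<close>

definition LUCB :: "('g::topological_group_add \<Rightarrow> real) set" where
  "LUCB = {\<phi>. bounded (range \<phi>) \<and>
     continuous_map euclidean (mtopology_of (funspace UNIV euclidean_metric)) (\<lambda>g h. \<phi> (h + g))}"

text \<open>
  The condition on the norm of \<open>m\<close> consists of the last two conjuncts before \<open>m 1 = 1\<close>;
  \<open>bdd_above\<close> is needed because \<open>SUP\<close> on the reals is unspecified for unbounded sets.
\<close>

definition is_mean :: "(('g::topological_group_add \<Rightarrow> real) \<Rightarrow> real) \<Rightarrow> bool" where
  "is_mean m \<longleftrightarrow>
     (\<forall>\<phi>\<in>LUCB. \<forall>\<psi>\<in>LUCB. m (\<lambda>g. \<phi> g + \<psi> g) = m \<phi> + m \<psi>) \<and>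
     (\<forall>c. \<forall>\<phi>\<in>LUCB. m (\<lambda>g. c * \<phi> g) = c * m \<phi>) \<and>
     (\<forall>\<phi>\<in>LUCB. (\<forall>g. 0 \<le> \<phi> g) \<longrightarrow> 0 \<le> m \<phi>) \<and>
     bdd_above ((\<lambda>\<phi>. \<bar>m \<phi>\<bar>) ` {\<phi>\<in>LUCB. \<forall>g. \<bar>\<phi> g\<bar> \<le> 1}) \<and>
     (SUP \<phi>\<in>{\<phi>\<in>LUCB. \<forall>g. \<bar>\<phi> g\<bar> \<le> 1}. \<bar>m \<phi>\<bar>) = 1 \<and>
     m (\<lambda>_. 1) = 1"

definition amenable :: "'g::topological_group_add itself \<Rightarrow> bool" where
  "amenable _ \<longleftrightarrow> (\<exists>m :: ('g \<Rightarrow> real) \<Rightarrow> real.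
     is_mean m \<and> (\<forall>g. \<forall>\<phi>\<in>LUCB. m (\<lambda>h. \<phi> (h + g)) = m \<phi>))"

definition skew_amenable :: "'g::topological_group_add itself \<Rightarrow> bool" where
  "skew_amenable _ \<longleftrightarrow> (\<exists>m :: ('g \<Rightarrow> real) \<Rightarrow> real.
     is_mean m \<and> (\<forall>g. \<forall>\<phi>\<in>LUCB. m (\<lambda>h. \<phi> (- g + h)) = m \<phi>))"


lemma LUCB_iff:
  "\<phi> \<in> LUCB \<longleftrightarrow> bounded (range \<phi>) \<and>
     (\<forall>g. \<forall>e>0. \<forall>\<^sub>F g' in nhds g. \<forall>h. \<bar>\<phi> (h + g') - \<phi> (h + g)\<bar> < e)"
proof (cases "bounded (range \<phi>)")
  case True
  let ?F = "funspace UNIV euclidean_metric :: ('a \<Rightarrow> real) metric"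
  let ?t = "\<lambda>g h. \<phi> (h + g)"
  interpret F: Metric_space "mspace ?F" "mdist ?F" by (rule Metric_space_mspace_mdist)
  have "bounded (range (?t g))" for g
    by (rule bounded_subset[OF True]) auto
  then have mem: "?t g \<in> mspace ?F" for g
    by (simp add: Met_TC.fspace_def Met_TC.mbounded_def bounded_def subset_iff)
  have d: "mdist ?F (?t g') (?t g) = (SUP h. \<bar>\<phi> (h + g') - \<phi> (h + g)\<bar>)" for g g'
    using mem[of g] mem[of g'] by (simp add: Met_TC.fdist_def dist_real_def)
  have bdd: "bdd_above (range (\<lambda>h. \<bar>\<phi> (h + g') - \<phi> (h + g)\<bar>))" for g g'
    using Met_TC.bdd_above_dist[of "?t g'" UNIV "?t g"] mem[of g] mem[of g']
    by (simp add: dist_real_def)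
  have lt: "\<bar>\<phi> (h + g') - \<phi> (h + g)\<bar> < e" if "mdist ?F (?t g') (?t g) < e" for g g' h e
    using cSUP_upper[OF UNIV_I bdd, of h g' g] that unfolding d by linarith
  have le: "mdist ?F (?t g') (?t g) \<le> e" if "\<forall>h. \<bar>\<phi> (h + g') - \<phi> (h + g)\<bar> < e" for g g' e
    unfolding d using that by (intro cSUP_least) (auto intro: less_imp_le)
  have ball: "?t g' \<in> F.mball (?t g) e \<longleftrightarrow> mdist ?F (?t g') (?t g) < e" for g g' e
    unfolding F.in_mball using mem F.commute[of "?t g" "?t g'"] by metis
  have "continuous_map euclidean (mtopology_of ?F) ?t \<longleftrightarrow>
      (\<forall>g. \<forall>e>0. \<forall>\<^sub>F g' in nhds g. mdist ?F (?t g') (?t g) < e)"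
    unfolding mtopology_of_def F.continuous_map_to_metric eventually_nhds ball
    by (simp only: open_openin topspace_euclidean UNIV_I ball_UNIV)
  also have "\<dots> \<longleftrightarrow> (\<forall>g. \<forall>e>0. \<forall>\<^sub>F g' in nhds g. \<forall>h. \<bar>\<phi> (h + g') - \<phi> (h + g)\<bar> < e)"
  proof (intro iffI allI impI)
    fix g and e :: real
    assume "\<forall>g. \<forall>e>0. \<forall>\<^sub>F g' in nhds g. mdist ?F (?t g') (?t g) < e" "0 < e"
    then have "\<forall>\<^sub>F g' in nhds g. mdist ?F (?t g') (?t g) < e" by blast
    then show "\<forall>\<^sub>F g' in nhds g. \<forall>h. \<bar>\<phi> (h + g') - \<phi> (h + g)\<bar> < e"
      by (rule eventually_mono) (use lt in blast)
  next
    fix g and e :: real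
    assume *: "\<forall>g. \<forall>e>0. \<forall>\<^sub>F g' in nhds g. \<forall>h. \<bar>\<phi> (h + g') - \<phi> (h + g)\<bar> < e" and "0 < e"
    then have "\<forall>\<^sub>F g' in nhds g. \<forall>h. \<bar>\<phi> (h + g') - \<phi> (h + g)\<bar> < e / 2"
      using half_gt_zero by blast
    then show "\<forall>\<^sub>F g' in nhds g. mdist ?F (?t g') (?t g) < e"
    proof (rule eventually_mono)
      fix g' assume "\<forall>h. \<bar>\<phi> (h + g') - \<phi> (h + g)\<bar> < e / 2"
      from le[OF this] show "mdist ?F (?t g') (?t g) < e" using \<open>0 < e\<close> by linarith
    qed
  qed
  finally show ?thesis using True by (simp add: LUCB_def)
qed (simp add: LUCB_def)


section \<open>Lipschitz functions modulo constants\<close>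

text \<open>
  A function on \<open>mspace m\<close> is represented by any HOL function extending it; the relation
  \<open>lip_rel m\<close> also identifies functions that agree on \<open>mspace m\<close>.
\<close>

definition Lip :: "'a metric \<Rightarrow> ('a \<Rightarrow> real) set" where
  "Lip m = {\<phi>. Lipschitz_continuous_map m euclidean_metric \<phi>}"

definition lip_rel :: "'a metric \<Rightarrow> (('a \<Rightarrow> real) \<times> ('a \<Rightarrow> real)) set" where
  "lip_rel m = {(\<phi>, \<psi>). \<phi> \<in> Lip m \<and> \<psi> \<in> Lip m \<and> (\<exists>c. \<forall>x\<in>mspace m. \<psi> x = \<phi> x + c)}"

definition lip_class :: "'a metric \<Rightarrow> ('a \<Rightarrow> real) \<Rightarrow> ('a \<Rightarrow> real) set" where
  "lip_class m \<phi> = lip_rel m `` {\<phi>}"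

definition LIP :: "'a metric \<Rightarrow> ('a \<Rightarrow> real) set set" where
  "LIP m = Lip m // lip_rel m"

definition LIP_add :: "'a metric \<Rightarrow> ('a \<Rightarrow> real) set \<Rightarrow> ('a \<Rightarrow> real) set \<Rightarrow> ('a \<Rightarrow> real) set" where
  "LIP_add m A B = (\<Union>\<phi>\<in>A. \<Union>\<psi>\<in>B. lip_class m (\<lambda>x. \<phi> x + \<psi> x))"

definition LIP_scale :: "'a metric \<Rightarrow> real \<Rightarrow> ('a \<Rightarrow> real) set \<Rightarrow> ('a \<Rightarrow> real) set" where
  "LIP_scale m c A = (\<Union>\<phi>\<in>A. lip_class m (\<lambda>x. c * \<phi> x))"

text \<open>The inserted \<open>0\<close> only matters when the space has at most one point.\<close>

definition lip_const :: "'a metric \<Rightarrow> ('a \<Rightarrow> real) \<Rightarrow> real" where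
  "lip_const m \<phi> = Sup (insert 0
     {\<bar>\<phi> x - \<phi> y\<bar> / mdist m x y | x y. x \<in> mspace m \<and> y \<in> mspace m \<and> x \<noteq> y})"

text \<open>\<open>lip_const m\<close> is constant on every class, see \<open>LIP_norm_class\<close> below.\<close>

definition LIP_norm :: "'a metric \<Rightarrow> ('a \<Rightarrow> real) set \<Rightarrow> real" where
  "LIP_norm m A = the_elem (lip_const m ` A)"

definition linear_contraction ::
    "'a metric \<Rightarrow> 'b metric \<Rightarrow> (('a \<Rightarrow> real) set \<Rightarrow> ('b \<Rightarrow> real) set) \<Rightarrow> bool" where
  "linear_contraction m n S \<longleftrightarrow>
     S \<in> LIP m \<rightarrow> LIP n \<and>
     (\<forall>A\<in>LIP m. \<forall>B\<in>LIP m. S (LIP_add m A B) = LIP_add n (S A) (S B)) \<and>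
     (\<forall>c. \<forall>A\<in>LIP m. S (LIP_scale m c A) = LIP_scale n c (S A)) \<and>
     (\<forall>A\<in>LIP m. LIP_norm n (S A) \<le> LIP_norm m A)"

lemma Lip_iff:
  "\<phi> \<in> Lip m \<longleftrightarrow> (\<exists>B. \<forall>x\<in>mspace m. \<forall>y\<in>mspace m. \<bar>\<phi> x - \<phi> y\<bar> \<le> B * mdist m x y)"
  by (simp add: Lip_def Lipschitz_continuous_map_def dist_real_def)

lemma Lip_add: 
  assumes "\<phi> \<in> Lip m" "\<psi> \<in> Lip m" shows "(\<lambda>x. \<phi> x + \<psi> x) \<in> Lip m"
proof -
  obtain B C where BC: "\<forall>x\<in>mspace m. \<forall>y\<in>mspace m. \<bar>\<phi> x - \<phi> y\<bar> \<le> B * mdist m x y"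
    "\<forall>x\<in>mspace m. \<forall>y\<in>mspace m. \<bar>\<psi> x - \<psi> y\<bar> \<le> C * mdist m x y"
    using assms unfolding Lip_iff by blast
  have "\<bar>(\<phi> x + \<psi> x) - (\<phi> y + \<psi> y)\<bar> \<le> (B + C) * mdist m x y" 
    if "x \<in> mspace m" "y \<in> mspace m" for x y
  proof -
    have "\<bar>\<phi> x - \<phi> y\<bar> \<le> B * mdist m x y" "\<bar>\<psi> x - \<psi> y\<bar> \<le> C * mdist m x y"
      using BC that by auto
    then show ?thesis by (simp add: distrib_right)
  qed
  then show ?thesis unfolding Lip_iff by blast
qed

lemma Lip_scale: 
  assumes "\<phi> \<in> Lip m" shows "(\<lambda>x. c * \<phi> x) \<in> Lip m"
proof -
  obtain B where B: "\<forall>x\<in>mspace m. \<forall>y\<in>mspace m. \<bar>\<phi> x - \<phi> y\<bar> \<le> B * mdist m x y"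
    using assms unfolding Lip_iff by blast
  have "\<bar>c * \<phi> x - c * \<phi> y\<bar> \<le> (\<bar>c\<bar> * B) * mdist m x y" 
    if "x \<in> mspace m" "y \<in> mspace m" for x y
  proof -
    have "\<bar>c * \<phi> x - c * \<phi> y\<bar> = \<bar>c\<bar> * \<bar>\<phi> x - \<phi> y\<bar>"
      by (simp add: abs_mult flip: right_diff_distrib)
    also have "\<dots> \<le> \<bar>c\<bar> * (B * mdist m x y)"
      using B that by (intro mult_left_mono) auto
    finally show ?thesis by (simp add: mult.assoc)
  qed
  then show ?thesis unfolding Lip_iff by blast
qed

lemma equiv_lip_rel: "equiv (Lip m) (lip_rel m)"
proof (rule equivI)
  show "lip_rel m \<subseteq> Lip m \<times> Lip m" by (auto simp: lip_rel_def)
  show "refl_on (Lip m) (lip_rel m)"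
    by (auto simp: refl_on_def lip_rel_def intro!: exI[of _ 0])
  show "sym (lip_rel m)"
  proof (rule symI)
    fix \<phi> \<psi> assume "(\<phi>, \<psi>) \<in> lip_rel m"
    then obtain c where "\<phi> \<in> Lip m" "\<psi> \<in> Lip m" "\<forall>x\<in>mspace m. \<psi> x = \<phi> x + c"
      by (auto simp: lip_rel_def)
    then show "(\<psi>, \<phi>) \<in> lip_rel m" by (auto simp: lip_rel_def intro!: exI[of _ "- c"])
  qed
  show "trans (lip_rel m)"
  proof (rule transI)
    fix \<phi> \<psi> \<eta> assume "(\<phi>, \<psi>) \<in> lip_rel m" "(\<psi>, \<eta>) \<in> lip_rel m"
    then obtain c c' where "\<phi> \<in> Lip m" "\<eta> \<in> Lip m" "\<forall>x\<in>mspace m. \<psi> x = \<phi> x + c"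
      "\<forall>x\<in>mspace m. \<eta> x = \<psi> x + c'"
      unfolding lip_rel_def by blast
    then show "(\<phi>, \<eta>) \<in> lip_rel m" by (auto simp: lip_rel_def intro!: exI[of _ "c + c'"])
  qed
qed

lemma mem_lip_class:
  "\<psi> \<in> lip_class m \<phi> \<longleftrightarrow>
     \<phi> \<in> Lip m \<and> \<psi> \<in> Lip m \<and> (\<exists>c. \<forall>x\<in>mspace m. \<psi> x = \<phi> x + c)"
  by (simp add: lip_class_def lip_rel_def)

lemma lip_class_eq:
  assumes "\<psi> \<in> lip_class m \<phi>" shows "lip_class m \<psi> = lip_class m \<phi>"
  using assms equiv_class_eq[OF equiv_lip_rel, of \<phi> \<psi> m] by (simp add: lip_class_def)

lemma lip_class_self: "\<phi> \<in> Lip m \<Longrightarrow> \<phi> \<in> lip_class m \<phi>"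
  by (auto simp: mem_lip_class intro!: exI[of _ 0])

lemma LIP_eq: "LIP m = lip_class m ` Lip m"
  by (auto simp: LIP_def quotient_def lip_class_def)

lemma LIP_add_class:
  assumes "\<phi> \<in> Lip m" "\<psi> \<in> Lip m"
  shows "LIP_add m (lip_class m \<phi>) (lip_class m \<psi>) = lip_class m (\<lambda>x. \<phi> x + \<psi> x)"
proof -
  have *: "lip_class m (\<lambda>x. \<phi>' x + \<psi>' x) = lip_class m (\<lambda>x. \<phi> x + \<psi> x)"
    if \<phi>': "\<phi>' \<in> lip_class m \<phi>" and \<psi>': "\<psi>' \<in> lip_class m \<psi>" for \<phi>' \<psi>'
  proof (rule lip_class_eq)
    obtain c d where "\<forall>x\<in>mspace m. \<phi>' x = \<phi> x + c" "\<forall>x\<in>mspace m. \<psi>' x = \<psi> x + d"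
      using \<phi>' \<psi>' by (auto simp: mem_lip_class)
    then have "\<forall>x\<in>mspace m. \<phi>' x + \<psi>' x = \<phi> x + \<psi> x + (c + d)" by simp
    moreover have "\<phi>' \<in> Lip m" "\<psi>' \<in> Lip m" using \<phi>' \<psi>' by (simp_all add: mem_lip_class)
    ultimately show "(\<lambda>x. \<phi>' x + \<psi>' x) \<in> lip_class m (\<lambda>x. \<phi> x + \<psi> x)"
      unfolding mem_lip_class using Lip_add assms by blast
  qed
  have ne: "lip_class m \<phi> \<noteq> {}" "lip_class m \<psi> \<noteq> {}"
    using assms lip_class_self by blast+
  have "LIP_add m (lip_class m \<phi>) (lip_class m \<psi>)
      = (\<Union>\<phi>'\<in>lip_class m \<phi>. \<Union>\<psi>'\<in>lip_class m \<psi>. lip_class m (\<lambda>x. \<phi> x + \<psi> x))"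
    unfolding LIP_add_def by (intro SUP_cong refl *)
  then show ?thesis using ne by simp
qed

lemma LIP_scale_class:
  assumes "\<phi> \<in> Lip m"
  shows "LIP_scale m c (lip_class m \<phi>) = lip_class m (\<lambda>x. c * \<phi> x)"
proof -
  have *: "lip_class m (\<lambda>x. c * \<phi>' x) = lip_class m (\<lambda>x. c * \<phi> x)"
    if \<phi>': "\<phi>' \<in> lip_class m \<phi>" for \<phi>'
  proof (rule lip_class_eq)
    obtain d where "\<forall>x\<in>mspace m. \<phi>' x = \<phi> x + d"
      using \<phi>' by (auto simp: mem_lip_class)
    then have "\<forall>x\<in>mspace m. c * \<phi>' x = c * \<phi> x + c * d" by (simp add: distrib_left)
    moreover have "\<phi>' \<in> Lip m" using \<phi>' by (simp add: mem_lip_class)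
    ultimately show "(\<lambda>x. c * \<phi>' x) \<in> lip_class m (\<lambda>x. c * \<phi> x)"
      unfolding mem_lip_class using Lip_scale assms by blast
  qed
  have ne: "lip_class m \<phi> \<noteq> {}"
    using assms lip_class_self by blast
  have "LIP_scale m c (lip_class m \<phi>) = (\<Union>\<phi>'\<in>lip_class m \<phi>. lip_class m (\<lambda>x. c * \<phi> x))"
    unfolding LIP_scale_def by (intro SUP_cong refl *)
  then show ?thesis using ne by simp
qed

lemma lip_const_cong:
  assumes "\<And>x. x \<in> mspace m \<Longrightarrow> \<psi> x = \<phi> x + c"
  shows "lip_const m \<psi> = lip_const m \<phi>"
proof -
  have "{\<bar>\<psi> x - \<psi> y\<bar> / mdist m x y | x y. x \<in> mspace m \<and> y \<in> mspace m \<and> x \<noteq> y}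
      = {\<bar>\<phi> x - \<phi> y\<bar> / mdist m x y | x y. x \<in> mspace m \<and> y \<in> mspace m \<and> x \<noteq> y}"
  proof -
    have "\<bar>\<psi> x - \<psi> y\<bar> = \<bar>\<phi> x - \<phi> y\<bar>" if "x \<in> mspace m" "y \<in> mspace m" for x y
      using assms that by simp
    then show ?thesis by (intro Collect_cong) force
  qed
  then show ?thesis by (simp add: lip_const_def)
qed

lemma LIP_norm_class:
  assumes "\<phi> \<in> Lip m"
  shows "LIP_norm m (lip_class m \<phi>) = lip_const m \<phi>"
proof -
  have "lip_const m ` lip_class m \<phi> = {lip_const m \<phi>}"
  proof (intro equalityI subsetI)
    fix r assume "r \<in> lip_const m ` lip_class m \<phi>"
    then obtain \<psi> c where "r = lip_const m \<psi>" "\<forall>x\<in>mspace m. \<psi> x = \<phi> x + c"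
      by (auto simp only: mem_lip_class)
    then show "r \<in> {lip_const m \<phi>}" using lip_const_cong[of m \<psi> \<phi> c] by simp
  qed (use lip_class_self[OF assms] in blast)
  then show ?thesis by (simp add: LIP_norm_def)
qed

lemma lip_const_le_iff:
  assumes "\<phi> \<in> Lip m" "0 \<le> B"
  shows "lip_const m \<phi> \<le> B \<longleftrightarrow> (\<forall>x\<in>mspace m. \<forall>y\<in>mspace m. \<bar>\<phi> x - \<phi> y\<bar> \<le> B * mdist m x y)"
proof -
  interpret Metric_space "mspace m" "mdist m" by simp
  let ?Q = "{\<bar>\<phi> x - \<phi> y\<bar> / mdist m x y | x y. x \<in> mspace m \<and> y \<in> mspace m \<and> x \<noteq> y}"
  have *: "(\<forall>q\<in>?Q. q \<le> C) \<longleftrightarrow>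
      (\<forall>x\<in>mspace m. \<forall>y\<in>mspace m. \<bar>\<phi> x - \<phi> y\<bar> \<le> C * mdist m x y)" for C
  proof -
    have 1: "\<bar>\<phi> x - \<phi> y\<bar> / mdist m x y \<le> C \<longleftrightarrow> \<bar>\<phi> x - \<phi> y\<bar> \<le> C * mdist m x y"
      if "x \<in> mspace m" "y \<in> mspace m" "x \<noteq> y" for x y
      using mdist_pos_eq[OF that(1,2)] that(3) by (simp add: pos_divide_le_eq)
    have 2: "\<bar>\<phi> x - \<phi> x\<bar> \<le> C * mdist m x x" if "x \<in> mspace m" for x
      using that by simp
    show ?thesis
    proof (intro iffI ballI)
      fix x y assume Q: "\<forall>q\<in>?Q. q \<le> C" and xy: "x \<in> mspace m" "y \<in> mspace m"
      show "\<bar>\<phi> x - \<phi> y\<bar> \<le> C * mdist m x y"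
      proof (cases "x = y")
        case False
        then have "\<bar>\<phi> x - \<phi> y\<bar> / mdist m x y \<le> C" using Q xy by blast
        then show ?thesis using 1[OF xy False] by simp
      qed (use 2 xy in simp)
    next
      fix q assume "\<forall>x\<in>mspace m. \<forall>y\<in>mspace m. \<bar>\<phi> x - \<phi> y\<bar> \<le> C * mdist m x y" "q \<in> ?Q"
      then show "q \<le> C" using 1 by blast
    qed
  qed
  obtain K where "\<forall>q\<in>?Q. q \<le> K"
    using assms(1) unfolding Lip_iff * by blast
  then have "bdd_above ?Q" by (intro bdd_aboveI[of _ K]) blast
  then have "bdd_above (insert 0 ?Q)" by simp
  then have "lip_const m \<phi> \<le> B \<longleftrightarrow> (\<forall>q\<in>insert 0 ?Q. q \<le> B)"
    unfolding lip_const_def by (intro cSup_le_iff) auto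
  with assms(2) * show ?thesis by simp
qed


section \<open>Isometric actions and the space of orbit closures\<close>

definition continuous_isometric_action ::
    "'x metric \<Rightarrow> ('g::topological_group_add \<Rightarrow> 'x \<Rightarrow> 'x) \<Rightarrow> bool" where
  "continuous_isometric_action X act \<longleftrightarrow>
     (\<forall>g. act g \<in> mspace X \<rightarrow> mspace X) \<and>
     (\<forall>x\<in>mspace X. act 0 x = x) \<and>
     (\<forall>g h. \<forall>x\<in>mspace X. act (g + h) x = act g (act h x)) \<and>
     (\<forall>g. \<forall>x\<in>mspace X. \<forall>y\<in>mspace X. mdist X (act g x) (act g y) = mdist X x y) \<and>
     continuous_map (prod_topology euclidean (mtopology_of X)) (mtopology_of X) (\<lambda>(g, x). act g x)"

definition orbit_closure :: "'x metric \<Rightarrow> ('g \<Rightarrow> 'x \<Rightarrow> 'x) \<Rightarrow> 'x \<Rightarrow> 'x set" where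
  "orbit_closure X act x = mtopology_of X closure_of (range (\<lambda>g. act g x))"

definition hausdorff_dist :: "'x metric \<Rightarrow> 'x set \<Rightarrow> 'x set \<Rightarrow> real" where
  "hausdorff_dist X A B =
     max (SUP a\<in>A. INF b\<in>B. mdist X a b) (SUP b\<in>B. INF a\<in>A. mdist X a b)"

text \<open>
  The type of abstract metrics requires nonnegativity and symmetry of the distance on the whole
  type, hence the value \<open>0\<close> outside the carrier.
\<close>

definition orbit_space :: "'x metric \<Rightarrow> ('g \<Rightarrow> 'x \<Rightarrow> 'x) \<Rightarrow> 'x set metric" where
  "orbit_space X act =
     (let M = orbit_closure X act ` mspace X
      in metric (M, \<lambda>A B. if A \<in> M \<and> B \<in> M then hausdorff_dist X A B else 0))"

context
  fixes X :: "'x metric" and act :: "'g::topological_group_add \<Rightarrow> 'x \<Rightarrow> 'x"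
  assumes action: "continuous_isometric_action X act"
begin

interpretation Metric_space "mspace X" "mdist X" by simp

lemma act_in [simp]: "x \<in> mspace X \<Longrightarrow> act g x \<in> mspace X"
  using action by (auto simp: continuous_isometric_action_def)

lemma act_zero: "x \<in> mspace X \<Longrightarrow> act 0 x = x"
  using action by (auto simp: continuous_isometric_action_def)

lemma act_add: "x \<in> mspace X \<Longrightarrow> act (g + h) x = act g (act h x)"
  using action by (auto simp: continuous_isometric_action_def)

lemma act_dist:
  "x \<in> mspace X \<Longrightarrow> y \<in> mspace X \<Longrightarrow> mdist X (act g x) (act g y) = mdist X x y"
  using action by (auto simp: continuous_isometric_action_def)

lemma act_dist_move:
  assumes "x \<in> mspace X" "y \<in> mspace X"
  shows "mdist X (act g x) (act h y) = mdist X (act (- h + g) x) y"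
proof -
  have "mdist X (act g x) (act h y) = mdist X (act (- h) (act g x)) (act (- h) (act h y))"
    using assms by (simp add: act_dist)
  also have "act (- h) (act h y) = y"
    using assms act_add[of y "- h" h] by (simp add: act_zero)
  finally show ?thesis using assms by (simp add: act_add)
qed

lemma orbit_closure_iff:
  assumes "x \<in> mspace X"
  shows "a \<in> orbit_closure X act x \<longleftrightarrow> a \<in> mspace X \<and> (\<forall>e>0. \<exists>g. mdist X a (act g x) < e)"
  using assms by (auto simp: orbit_closure_def mtopology_of_def metric_closure_of)

lemma self_in_orbit_closure: "x \<in> mspace X \<Longrightarrow> x \<in> orbit_closure X act x"
  using act_zero[of x] by (auto simp: orbit_closure_iff intro!: exI[of _ 0])

lemma orbit_dist_le:
  assumes "x \<in> mspace X" "y \<in> mspace X"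
  shows "(INF h. mdist X (act h x) y) \<le> mdist X (act g x) y"
  by (rule cINF_lower) (auto intro!: bdd_belowI[of _ 0])

lemma orbit_dist_less:
  assumes "x \<in> mspace X" "y \<in> mspace X" "0 < e"
  obtains h where "mdist X (act h x) y < (INF h. mdist X (act h x) y) + e"
proof -
  have "(INF h. mdist X (act h x) y) < (INF h. mdist X (act h x) y) + e" using assms by simp
  then have "\<exists>h. mdist X (act h x) y < (INF h. mdist X (act h x) y) + e"
    by (subst (asm) cINF_less_iff) (auto intro!: bdd_belowI[of _ 0])
  then show ?thesis using that by blast
qed

lemma orbit_dist_commute:
  assumes "x \<in> mspace X" "y \<in> mspace X"
  shows "(INF h. mdist X (act h x) y) = (INF h. mdist X (act h y) x)"
proof -
  have "mdist X (act h x) y = mdist X (act (- h) y) x" 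
    if "x \<in> mspace X" "y \<in> mspace X" for h x y
    using act_dist_move[OF that, of h 0] act_dist_move[OF that(2,1), of 0 h] that
    by (simp add: act_zero commute)
  then have "range (\<lambda>h. mdist X (act h x) y) = range (\<lambda>h. mdist X (act h y) x)"
    using assms by blast
  then show ?thesis by simp
qed

lemma INF_orbit_closure:
  assumes x: "x \<in> mspace X" and y: "y \<in> mspace X" and a: "a \<in> orbit_closure X act x"
  shows "(INF b\<in>orbit_closure X act y. mdist X a b) = (INF h. mdist X (act h x) y)"
proof (rule antisym)
  let ?D = "INF h. mdist X (act h x) y"
  have aX: "a \<in> mspace X" using a orbit_closure_iff x by blast
  show "?D \<le> (INF b\<in>orbit_closure X act y. mdist X a b)"
  proof (rule cINF_greatest)
    show "orbit_closure X act y \<noteq> {}" using self_in_orbit_closure y by blast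
    fix b assume b: "b \<in> orbit_closure X act y"
    then have bX: "b \<in> mspace X" using orbit_closure_iff y by blast
    show "?D \<le> mdist X a b"
    proof (rule field_le_epsilon)
      fix e :: real assume "0 < e"
      then have e: "0 < e / 2" by simp
      obtain g where g: "mdist X a (act g x) < e / 2"
        using a e orbit_closure_iff[OF x] by blast
      obtain h where h: "mdist X b (act h y) < e / 2"
        using b e orbit_closure_iff[OF y] by blast
      have "?D \<le> mdist X (act g x) (act h y)"
        using orbit_dist_le[OF x y] act_dist_move[OF x y] by simp
      also have "\<dots> \<le> mdist X (act g x) a + mdist X a (act h y)"
        using triangle aX x y by simp
      also have "mdist X a (act h y) \<le> mdist X a b + mdist X b (act h y)"
        using triangle aX bX y by simp
      finally show "?D \<le> mdist X a b + e" using g h by (simp add: commute)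
    qed
  qed
  show "(INF b\<in>orbit_closure X act y. mdist X a b) \<le> ?D"
  proof (rule field_le_epsilon)
    fix e :: real assume "0 < e"
    then have e: "0 < e / 2" by simp
    obtain g where g: "mdist X a (act g x) < e / 2"
      using a e orbit_closure_iff[OF x] by blast
    obtain h where h: "mdist X (act h x) y < ?D + e / 2"
      using orbit_dist_less[OF x y e] by blast
    let ?b = "act (g + - h) y"
    have b: "?b \<in> orbit_closure X act y"
      unfolding orbit_closure_iff[OF y] using y by (auto intro!: exI[of _ "g + - h"])
    have "(INF b\<in>orbit_closure X act y. mdist X a b) \<le> mdist X a ?b"
      by (rule cINF_lower[OF _ b]) (auto intro!: bdd_belowI[of _ 0])
    also have "\<dots> \<le> mdist X a (act g x) + mdist X (act g x) ?b"
      using triangle aX x y by simp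
    also have "mdist X (act g x) ?b = mdist X (act h x) y"
      using act_dist_move[OF x y, of g "g + - h"]
      by (simp add: minus_add add.assoc)
    finally show "(INF b\<in>orbit_closure X act y. mdist X a b) \<le> ?D + e" using g h by simp
  qed
qed

lemma hausdorff_dist_orbit_closure:
  assumes x: "x \<in> mspace X" and y: "y \<in> mspace X"
  shows "hausdorff_dist X (orbit_closure X act x) (orbit_closure X act y)
       = (INF h. mdist X (act h x) y)"
proof -
  have ne: "orbit_closure X act x \<noteq> {}" "orbit_closure X act y \<noteq> {}"
    using self_in_orbit_closure x y by blast+
  have "(SUP a\<in>orbit_closure X act x. INF b\<in>orbit_closure X act y. mdist X a b)
      = (SUP a\<in>orbit_closure X act x. INF h. mdist X (act h x) y)"
    by (rule SUP_cong[OF refl]) (rule INF_orbit_closure[OF x y])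
  moreover have "(SUP b\<in>orbit_closure X act y. INF a\<in>orbit_closure X act x. mdist X a b)
      = (SUP b\<in>orbit_closure X act y. INF h. mdist X (act h x) y)"
  proof (rule SUP_cong[OF refl])
    fix b assume "b \<in> orbit_closure X act y"
    then have "(INF a\<in>orbit_closure X act x. mdist X b a) = (INF h. mdist X (act h y) x)"
      by (rule INF_orbit_closure[OF y x])
    then show "(INF a\<in>orbit_closure X act x. mdist X a b) = (INF h. mdist X (act h x) y)"
      unfolding orbit_dist_commute[OF x y] by (simp only: commute[of b])
  qed
  ultimately show ?thesis using ne by (simp add: hausdorff_dist_def)
qed

lemma orbit_closure_subset:
  assumes x: "x \<in> mspace X" and y: "y \<in> mspace X" and 0: "(INF h. mdist X (act h x) y) = 0"
  shows "orbit_closure X act x \<subseteq> orbit_closure X act y"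
proof
  fix a assume a: "a \<in> orbit_closure X act x"
  then have aX: "a \<in> mspace X" using orbit_closure_iff x by blast
  have "\<exists>g. mdist X a (act g y) < e" if "0 < e" for e
  proof -
    have e: "0 < e / 2" using that by simp
    obtain g where g: "mdist X a (act g x) < e / 2"
      using a e orbit_closure_iff[OF x] by blast
    obtain h where h: "mdist X (act h x) y < e / 2"
      using orbit_dist_less[OF x y e] 0 by auto
    have "mdist X a (act (g + - h) y) \<le> mdist X a (act g x) + mdist X (act g x) (act (g + - h) y)"
      using triangle aX x y by simp
    also have "mdist X (act g x) (act (g + - h) y) = mdist X (act h x) y"
      using act_dist_move[OF x y, of g "g + - h"] by (simp add: minus_add add.assoc)
    finally show ?thesis using g h by (intro exI[of _ "g + - h"]) simp
  qed
  then show "a \<in> orbit_closure X act y" using aX orbit_closure_iff[OF y] by blast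
qed

lemma orbit_dist_triangle:
  assumes x: "x \<in> mspace X" and y: "y \<in> mspace X" and z: "z \<in> mspace X"
  shows "(INF h. mdist X (act h x) z) \<le> (INF h. mdist X (act h x) y) + (INF h. mdist X (act h y) z)"
proof (rule field_le_epsilon)
  fix e :: real assume "0 < e"
  then have e: "0 < e / 2" by simp
  obtain g where g: "mdist X (act g x) y < (INF h. mdist X (act h x) y) + e / 2"
    using orbit_dist_less[OF x y e] by blast
  obtain h where h: "mdist X (act h y) z < (INF h. mdist X (act h y) z) + e / 2"
    using orbit_dist_less[OF y z e] by blast
  have "(INF h. mdist X (act h x) z) \<le> mdist X (act (h + g) x) z"
    by (rule orbit_dist_le[OF x z])
  also have "\<dots> \<le> mdist X (act h (act g x)) (act h y) + mdist X (act h y) z"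
    using triangle x y z by (simp add: act_add)
  also have "mdist X (act h (act g x)) (act h y) = mdist X (act g x) y"
    using x y by (simp add: act_dist)
  finally show "(INF h. mdist X (act h x) z)
      \<le> (INF h. mdist X (act h x) y) + (INF h. mdist X (act h y) z) + e"
    using g h by simp
qed

lemma Metric_space_orbit_space:
  fixes M defines "M \<equiv> orbit_closure X act ` mspace X"
  shows "Metric_space M (\<lambda>A B. if A \<in> M \<and> B \<in> M then hausdorff_dist X A B else 0)"
proof
  have nonneg: "0 \<le> hausdorff_dist X A B" if "A \<in> M" "B \<in> M" for A B
    using that unfolding M_def
    by (auto simp: hausdorff_dist_orbit_closure intro!: cINF_greatest)
  then show "0 \<le> (if A \<in> M \<and> B \<in> M then hausdorff_dist X A B else 0)" for A B
    by simp
  show "(if A \<in> M \<and> B \<in> M then hausdorff_dist X A B else 0)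
      = (if B \<in> M \<and> A \<in> M then hausdorff_dist X B A else 0)" for A B
    unfolding hausdorff_dist_def by (simp add: commute max.commute)
  show "(if A \<in> M \<and> B \<in> M then hausdorff_dist X A B else 0) = 0 \<longleftrightarrow> A = B"
    if AB: "A \<in> M" "B \<in> M" for A B
  proof -
    obtain x y where x: "x \<in> mspace X" and A: "A = orbit_closure X act x"
      and y: "y \<in> mspace X" and B: "B = orbit_closure X act y" using AB M_def by blast
    have "A = B" if "hausdorff_dist X A B = 0"
      using that hausdorff_dist_orbit_closure[OF x y] orbit_closure_subset[OF x y]
        orbit_closure_subset[OF y x] orbit_dist_commute[OF x y] A B by auto
    moreover have "hausdorff_dist X A B = 0" if "A = B"
    proof -
      have "(INF h. mdist X (act h x) x) \<le> 0"
        using orbit_dist_le[OF x x, of 0] x by (simp add: act_zero)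
      moreover have "0 \<le> (INF h. mdist X (act h x) x)"
        by (rule cINF_greatest) auto
      ultimately show ?thesis
        using hausdorff_dist_orbit_closure[OF x x] A that by simp
    qed
    ultimately show ?thesis using AB by auto
  qed
  show "(if A \<in> M \<and> C \<in> M then hausdorff_dist X A C else 0)
      \<le> (if A \<in> M \<and> B \<in> M then hausdorff_dist X A B else 0)
        + (if B \<in> M \<and> C \<in> M then hausdorff_dist X B C else 0)"
    if "A \<in> M" "B \<in> M" "C \<in> M" for A B C
    using that unfolding M_def
    by (auto simp: hausdorff_dist_orbit_closure orbit_dist_triangle)
qed

lemma mspace_orbit_space: "mspace (orbit_space X act) = orbit_closure X act ` mspace X"
  by (simp add: orbit_space_def Let_def Metric_space.mspace_metric[OF Metric_space_orbit_space])

lemma mdist_orbit_space: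
  assumes "x \<in> mspace X" "y \<in> mspace X"
  shows "mdist (orbit_space X act) (orbit_closure X act x) (orbit_closure X act y)
       = (INF h. mdist X (act h x) y)"
  using assms hausdorff_dist_orbit_closure
  by (simp add: orbit_space_def Let_def Metric_space.mdist_metric[OF Metric_space_orbit_space])

end

end

theory Submission
  imports Defs
begin

text \<open>
  For a mean \<open>m\<close> and a Lipschitz function \<open>\<phi>\<close>, averaging the bounded functions
  \<open>g \<mapsto> \<phi> (g x) - \<phi> (g y)\<close> defines a Lipschitz function modulo constants, and the
  Lipschitz constant does not increase. Averaging with a skew-invariant mean gives a
  \<open>G\<close>-invariant operator \<open>T\<close>. Averaging with an invariant mean gives an operator \<open>T'\<close> such that
  \<open>T' \<phi> (h x) - T' \<phi> x\<close> does not depend on \<open>x\<close>; as a function of \<open>h\<close> it is a continuous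
  homomorphism to the reals, so it vanishes under either alternative of the hypothesis. Hence
  \<open>T' (T \<phi>)\<close> is constant on orbits and descends to the orbit space.
\<close>

section \<open>Means\<close>

lemma LUCB_const: "(\<lambda>_. c) \<in> LUCB"
  by (simp add: LUCB_iff)

lemma LUCB_add:
  assumes "\<phi> \<in> LUCB" "\<psi> \<in> LUCB" shows "(\<lambda>g. \<phi> g + \<psi> g) \<in> LUCB"
  unfolding LUCB_iff
proof (intro conjI allI impI)
  show "bounded (range (\<lambda>g. \<phi> g + \<psi> g))"
    using assms by (intro bounded_plus_comp) (simp_all add: LUCB_iff)
  fix g and e :: real assume "0 < e"
  then have "\<forall>\<^sub>F g' in nhds g. \<forall>h. \<bar>\<phi> (h + g') - \<phi> (h + g)\<bar> < e / 2"
    "\<forall>\<^sub>F g' in nhds g. \<forall>h. \<bar>\<psi> (h + g') - \<psi> (h + g)\<bar> < e / 2"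
    using assms half_gt_zero unfolding LUCB_iff by blast+
  then show "\<forall>\<^sub>F g' in nhds g. \<forall>h. \<bar>\<phi> (h + g') + \<psi> (h + g') - (\<phi> (h + g) + \<psi> (h + g))\<bar> < e"
  proof eventually_elim
    case (elim g')
    show ?case
    proof
      fix h
      show "\<bar>\<phi> (h + g') + \<psi> (h + g') - (\<phi> (h + g) + \<psi> (h + g))\<bar> < e"
        using elim[THEN spec[of _ h]] by linarith
    qed
  qed
qed

lemma LUCB_scale:
  assumes "\<phi> \<in> LUCB" shows "(\<lambda>g. c * \<phi> g) \<in> LUCB"
  unfolding LUCB_iff
proof (intro conjI allI impI)
  show "bounded (range (\<lambda>g. c * \<phi> g))"
    using assms bounded_scaling[of "range \<phi>" c] by (simp add: LUCB_iff image_image)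
  fix g and e :: real assume "0 < e"
  \<comment> \<open>The summand 1 keeps the divisor positive when \<open>c\<close> is 0.\<close>
  then have "0 < e / (\<bar>c\<bar> + 1)" by simp
  then have "\<forall>\<^sub>F g' in nhds g. \<forall>h. \<bar>\<phi> (h + g') - \<phi> (h + g)\<bar> < e / (\<bar>c\<bar> + 1)"
    using assms unfolding LUCB_iff by blast
  then show "\<forall>\<^sub>F g' in nhds g. \<forall>h. \<bar>c * \<phi> (h + g') - c * \<phi> (h + g)\<bar> < e"
  proof eventually_elim
    case (elim g')
    show ?case
    proof
      fix h
      let ?d = "\<bar>\<phi> (h + g') - \<phi> (h + g)\<bar>"
      have "\<bar>c * \<phi> (h + g') - c * \<phi> (h + g)\<bar> = \<bar>c\<bar> * ?d"
        by (simp add: abs_mult flip: right_diff_distrib)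
      also have "\<dots> \<le> (\<bar>c\<bar> + 1) * ?d" by (intro mult_right_mono) auto
      also have "\<dots> < e"
        using elim[THEN spec[of _ h]] by (simp add: pos_less_divide_eq mult.commute)
      finally show "\<bar>c * \<phi> (h + g') - c * \<phi> (h + g)\<bar> < e" .
    qed
  qed
qed

context
  fixes m :: "('g::topological_group_add \<Rightarrow> real) \<Rightarrow> real"
  assumes mean: "is_mean m"
begin

lemma mean_add: "\<phi> \<in> LUCB \<Longrightarrow> \<psi> \<in> LUCB \<Longrightarrow> m (\<lambda>g. \<phi> g + \<psi> g) = m \<phi> + m \<psi>"
  using mean by (simp add: is_mean_def)

lemma mean_scale: "\<phi> \<in> LUCB \<Longrightarrow> m (\<lambda>g. c * \<phi> g) = c * m \<phi>"
  using mean by (simp add: is_mean_def)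

lemma mean_const: "m (\<lambda>_. c) = c"
  using mean mean_scale[OF LUCB_const, of c 1] by (simp add: is_mean_def)

lemma mean_le:
  assumes "\<phi> \<in> LUCB" "\<And>g. \<phi> g \<le> B" shows "m \<phi> \<le> B"
proof -
  \<comment> \<open>Positivity of \<open>m\<close> is applied to B - \<phi>, written as a sum and a
    multiple so that the closure rules for \<open>LUCB\<close> apply.\<close>
  let ?\<psi> = "\<lambda>g. B + (-1) * \<phi> g"
  have "?\<psi> \<in> LUCB" by (intro LUCB_add LUCB_scale LUCB_const assms)
  then have "0 \<le> m ?\<psi>" using mean assms by (simp add: is_mean_def)
  also have "m ?\<psi> = B - m \<phi>"
    using mean_add[OF LUCB_const LUCB_scale[OF assms(1)], of B "-1"] mean_const
      mean_scale[OF assms(1), of "-1"] by simp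
  finally show ?thesis by simp
qed

lemma mean_abs_le:
  assumes "\<phi> \<in> LUCB" "\<And>g. \<bar>\<phi> g\<bar> \<le> B" shows "\<bar>m \<phi>\<bar> \<le> B"
proof -
  have "m \<phi> \<le> B" using assms(2) by (intro mean_le[OF assms(1)]) (simp add: abs_le_iff)
  moreover have "m (\<lambda>g. -1 * \<phi> g) \<le> B"
    using assms(2) by (intro mean_le[OF LUCB_scale[OF assms(1)]]) (simp add: abs_le_iff)
  ultimately show ?thesis using mean_scale[OF assms(1), of "-1"] by simp
qed

end

section \<open>Lipschitz functions\<close>

text \<open>The set under \<open>Sup\<close> contains 0 by construction. What needs proof is that it
  is bounded above, since otherwise \<open>Sup\<close> is unspecified.\<close>

lemma lip_const_nonneg:
  assumes "\<phi> \<in> Lip m" shows "0 \<le> lip_const m \<phi>"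
proof -
  interpret Metric_space "mspace m" "mdist m" by simp
  obtain B where B: "\<forall>x\<in>mspace m. \<forall>y\<in>mspace m. \<bar>\<phi> x - \<phi> y\<bar> \<le> B * mdist m x y"
    using assms unfolding Lip_iff by blast
  have "\<bar>\<phi> x - \<phi> y\<bar> / mdist m x y \<le> B" if "x \<in> mspace m" "y \<in> mspace m" "x \<noteq> y" for x y
    using mdist_pos_eq[OF that(1,2)] that B by (simp add: pos_divide_le_eq)
  then have "bdd_above
      {\<bar>\<phi> x - \<phi> y\<bar> / mdist m x y | x y. x \<in> mspace m \<and> y \<in> mspace m \<and> x \<noteq> y}"
    by (intro bdd_aboveI[of _ B]) auto
  then show ?thesis unfolding lip_const_def by (intro cSup_upper) auto
qed

lemma lip_const_bound:
  assumes "\<phi> \<in> Lip m" "x \<in> mspace m" "y \<in> mspace m"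
  shows "\<bar>\<phi> x - \<phi> y\<bar> \<le> lip_const m \<phi> * mdist m x y"
  using lip_const_le_iff[OF assms(1) lip_const_nonneg[OF assms(1)]] assms(2,3) by blast

lemma LipI_lip_const:
  assumes "\<And>x y. x \<in> mspace m \<Longrightarrow> y \<in> mspace m \<Longrightarrow> \<bar>\<phi> x - \<phi> y\<bar> \<le> B * mdist m x y" "0 \<le> B"
  shows "\<phi> \<in> Lip m" "lip_const m \<phi> \<le> B"
proof -
  show "\<phi> \<in> Lip m" unfolding Lip_iff using assms(1) by blast
  then show "lip_const m \<phi> \<le> B" using lip_const_le_iff assms by blast
qed

lemma lip_class_eqI:
  assumes "\<phi> \<in> Lip m" "\<psi> \<in> Lip m" "\<And>x. x \<in> mspace m \<Longrightarrow> \<psi> x = \<phi> x + c"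
  shows "lip_class m \<psi> = lip_class m \<phi>"
  using assms by (intro lip_class_eq) (auto simp: mem_lip_class)

section \<open>Averages along orbits\<close>

text \<open>The base point only normalises representatives: for Lipschitz \<phi> and a mean, another
  choice of base point changes the average below by a constant. If the space is empty the value is
  arbitrary.\<close>

definition base :: "'x metric \<Rightarrow> 'x" where
  "base X = (SOME x. x \<in> mspace X)"

lemma base_in: "x \<in> mspace X \<Longrightarrow> base X \<in> mspace X"
  unfolding base_def by (rule someI)

text \<open>The function g \<mapsto> \<phi> (g x) may be unbounded, so a mean need not apply to it.
  Subtracting the value at the translated base point leaves a function bounded by the Lipschitz
  constant times the distance from x to the base point.\<close>

definition orbit_average ::
    "(('g \<Rightarrow> real) \<Rightarrow> real) \<Rightarrow> 'x metric \<Rightarrow> ('g \<Rightarrow> 'x \<Rightarrow> 'x) \<Rightarrow> ('x \<Rightarrow> real) \<Rightarrow> 'x \<Rightarrow> real" where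
  "orbit_average m X act \<phi> x = m (\<lambda>g. \<phi> (act g x) - \<phi> (act g (base X)))"

text \<open>The value depends on the chosen representative in general;
  \<open>orbit_descend_lip\<close> shows that it does not for a Lipschitz function that is constant
  on orbits.\<close>

definition orbit_descend ::
    "'x metric \<Rightarrow> ('g \<Rightarrow> 'x \<Rightarrow> 'x) \<Rightarrow> ('x \<Rightarrow> real) \<Rightarrow> 'x set \<Rightarrow> real" where
  "orbit_descend X act \<phi> A = \<phi> (SOME x. x \<in> mspace X \<and> orbit_closure X act x = A)"

context
  fixes X :: "'x metric" and act :: "'g::topological_group_add \<Rightarrow> 'x \<Rightarrow> 'x"
  assumes action: "continuous_isometric_action X act"
begin

interpretation Metric_space "mspace X" "mdist X" by simp

lemmas act_in = act_in[OF action] and act_dist = act_dist[OF action]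
  and act_add = act_add[OF action] and act_zero = act_zero[OF action]

section \<open>Uniform continuity of Lipschitz functions along orbits\<close>

lemma eventually_act_dist:
  assumes "x \<in> mspace X" "0 < e"
  shows "\<forall>\<^sub>F g' in nhds g. mdist X (act g' x) (act g x) < e"
proof -
  have "continuous_map (prod_topology euclidean (mtopology_of X)) (mtopology_of X)
      (\<lambda>(g, x). act g x)"
    using action by (simp add: continuous_isometric_action_def)
  moreover have "continuous_map euclidean (prod_topology euclidean (mtopology_of X)) (\<lambda>g. (g, x))"
    using assms by (simp add: continuous_map_pairedI)
  ultimately have "continuous_map euclidean mtopology (\<lambda>g. act g x)"
    using continuous_map_compose[of euclidean _ "\<lambda>g. (g, x)" "mtopology_of X" "\<lambda>(g, x). act g x"]
    by (simp add: o_def mtopology_of_def)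
  then have "\<exists>U. open U \<and> g \<in> U \<and> (\<forall>g'\<in>U. act g' x \<in> mball (act g x) e)"
    unfolding continuous_map_to_metric open_openin[symmetric] topspace_euclidean
    using assms(2) by blast
  then show ?thesis
    unfolding eventually_nhds in_mball by (auto simp: commute)
qed

text \<open>In \<phi> (h g' z) - \<phi> (h g z) the element h acts last and is an isometry, so the
  Lipschitz bound is a multiple of the distance from g' z to g z, uniformly in h. Continuity of the
  orbit maps of x and y then suffices.\<close>

lemma orbit_diff_LUCB:
  assumes \<phi>: "\<phi> \<in> Lip X" and x: "x \<in> mspace X" and y: "y \<in> mspace X"
  shows "(\<lambda>g. \<phi> (act g x) - \<phi> (act g y)) \<in> LUCB"
  unfolding LUCB_iff
proof (intro conjI allI impI)
  let ?L = "lip_const X \<phi>"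
  have L: "0 \<le> ?L" by (rule lip_const_nonneg[OF \<phi>])
  have "\<bar>\<phi> (act g x) - \<phi> (act g y)\<bar> \<le> ?L * mdist X x y" for g
    using lip_const_bound[OF \<phi>, of "act g x" "act g y"] x y by (simp add: act_in act_dist)
  then show "bounded (range (\<lambda>g. \<phi> (act g x) - \<phi> (act g y)))"
    by (auto simp: bounded_iff)
  fix g and e :: real assume "0 < e"
  \<comment> \<open>Each of the two orbits contributes less than e / 2; the 1 covers a vanishing
    Lipschitz constant.\<close>
  define d where "d = e / (2 * (?L + 1))"
  have d: "0 < d" "?L * d < e / 2"
    using \<open>0 < e\<close> L by (simp_all add: d_def field_simps)
  have *: "\<bar>\<phi> (act (h + g') z) - \<phi> (act (h + g) z)\<bar> < e / 2"
    if "z \<in> mspace X" "mdist X (act g' z) (act g z) < d" for h g' z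
  proof -
    have "\<bar>\<phi> (act (h + g') z) - \<phi> (act (h + g) z)\<bar> \<le> ?L * mdist X (act g' z) (act g z)"
      using lip_const_bound[OF \<phi>, of "act (h + g') z" "act (h + g) z"] that
      by (simp add: act_in act_add act_dist)
    also have "\<dots> \<le> ?L * d" using that L by (intro mult_left_mono) auto
    finally show ?thesis using d by linarith
  qed
  have "\<forall>\<^sub>F g' in nhds g. mdist X (act g' x) (act g x) < d"
    "\<forall>\<^sub>F g' in nhds g. mdist X (act g' y) (act g y) < d"
    using eventually_act_dist x y d by blast+
  then show "\<forall>\<^sub>F g' in nhds g. \<forall>h. \<bar>\<phi> (act (h + g') x) - \<phi> (act (h + g') y)
      - (\<phi> (act (h + g) x) - \<phi> (act (h + g) y))\<bar> < e"
  proof eventually_elim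
    case (elim g')
    show ?case
    proof
      fix h
      show "\<bar>\<phi> (act (h + g') x) - \<phi> (act (h + g') y)
          - (\<phi> (act (h + g) x) - \<phi> (act (h + g) y))\<bar> < e"
        using *[OF x elim(1), of h] *[OF y elim(2), of h] by linarith
    qed
  qed
qed

lemma Lip_translate:
  assumes "\<phi> \<in> Lip X" shows "(\<lambda>x. \<phi> (act g x)) \<in> Lip X"
proof (rule LipI_lip_const(1))
  show "\<bar>\<phi> (act g x) - \<phi> (act g y)\<bar> \<le> lip_const X \<phi> * mdist X x y"
    if "x \<in> mspace X" "y \<in> mspace X" for x y
    using lip_const_bound[OF assms, of "act g x" "act g y"] that by (simp add: act_in act_dist)
qed (rule lip_const_nonneg[OF assms])

section \<open>Averaging against a fixed mean\<close>

context
  fixes m :: "('g \<Rightarrow> real) \<Rightarrow> real"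
  assumes mean: "is_mean m"
begin

text \<open>By additivity of the mean the terms at the base point cancel.\<close>

lemma orbit_average_diff:
  assumes "\<phi> \<in> Lip X" "x \<in> mspace X" "y \<in> mspace X"
  shows "orbit_average m X act \<phi> x - orbit_average m X act \<phi> y
    = m (\<lambda>g. \<phi> (act g x) - \<phi> (act g y))"
  using mean_add[OF mean orbit_diff_LUCB[OF assms]
      orbit_diff_LUCB[OF assms(1,3) base_in[OF assms(2)]]]
  by (simp add: orbit_average_def)

lemma orbit_average_lip:
  assumes \<phi>: "\<phi> \<in> Lip X"
  shows "orbit_average m X act \<phi> \<in> Lip X"
    "lip_const X (orbit_average m X act \<phi>) \<le> lip_const X \<phi>"
proof -
  have "\<bar>orbit_average m X act \<phi> x - orbit_average m X act \<phi> y\<bar> \<le> lip_const X \<phi> * mdist X x y"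
    if xy: "x \<in> mspace X" "y \<in> mspace X" for x y
    unfolding orbit_average_diff[OF \<phi> xy]
  proof (rule mean_abs_le[OF mean orbit_diff_LUCB[OF \<phi> xy]])
    show "\<bar>\<phi> (act g x) - \<phi> (act g y)\<bar> \<le> lip_const X \<phi> * mdist X x y" for g
      using lip_const_bound[OF \<phi>, of "act g x" "act g y"] xy by (simp add: act_in act_dist)
  qed
  then show "orbit_average m X act \<phi> \<in> Lip X"
    "lip_const X (orbit_average m X act \<phi>) \<le> lip_const X \<phi>"
    using LipI_lip_const lip_const_nonneg[OF \<phi>] by blast+
qed

lemma orbit_average_add:
  assumes "\<phi> \<in> Lip X" "\<psi> \<in> Lip X" "x \<in> mspace X"
  shows "orbit_average m X act (\<lambda>x. \<phi> x + \<psi> x) x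
    = orbit_average m X act \<phi> x + orbit_average m X act \<psi> x"
  using mean_add[OF mean orbit_diff_LUCB[OF assms(1,3) base_in[OF assms(3)]]
      orbit_diff_LUCB[OF assms(2,3) base_in[OF assms(3)]]]
  by (simp add: orbit_average_def algebra_simps)

lemma orbit_average_scale:
  assumes "\<phi> \<in> Lip X" "x \<in> mspace X"
  shows "orbit_average m X act (\<lambda>x. c * \<phi> x) x = c * orbit_average m X act \<phi> x"
  using mean_scale[OF mean orbit_diff_LUCB[OF assms base_in[OF assms(2)]], of c]
  by (simp add: orbit_average_def right_diff_distrib)

text \<open>An additive constant cancels inside the difference that is averaged. This makes
  averaging well defined modulo constants, and with \<open>c\<close> equal to 0 it allows rewriting
  under a second average.\<close>

lemma orbit_average_cong:
  assumes "\<And>x. x \<in> mspace X \<Longrightarrow> \<psi> x = \<phi> x + c" "x \<in> mspace X"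
  shows "orbit_average m X act \<psi> x = orbit_average m X act \<phi> x"
  using assms base_in[OF assms(2)] by (simp add: orbit_average_def act_in)

lemma orbit_average_invariant:
  assumes "\<And>g x. x \<in> mspace X \<Longrightarrow> \<phi> (act g x) = \<phi> x" "x \<in> mspace X"
  shows "orbit_average m X act \<phi> x = \<phi> x - \<phi> (base X)"
  using assms base_in[OF assms(2)] by (simp add: orbit_average_def mean_const[OF mean])

text \<open>Precomposing \<phi> with the action of - g translates the averaged function on the left,
  which is the translation that skew-invariance absorbs.\<close>

lemma orbit_average_skew:
  assumes skew: "\<And>g \<phi>. \<phi> \<in> LUCB \<Longrightarrow> m (\<lambda>h. \<phi> (- g + h)) = m \<phi>"
    and "\<phi> \<in> Lip X" and x: "x \<in> mspace X"
  shows "orbit_average m X act (\<lambda>x. \<phi> (act (- g) x)) x = orbit_average m X act \<phi> x"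
  using skew[OF orbit_diff_LUCB[OF assms(2) x base_in[OF x]], of g] x base_in[OF x]
  by (simp add: orbit_average_def act_add)

text \<open>Right invariance makes the average invariant only up to an additive constant \<xi> h for
  each h. These constants form a continuous homomorphism, which \<open>alt\<close> forces to
  vanish.\<close>

lemma orbit_average_constant_on_orbits:
  assumes inv: "\<And>g \<phi>. \<phi> \<in> LUCB \<Longrightarrow> m (\<lambda>h. \<phi> (h + g)) = m \<phi>"
    and alt: "(\<exists>D. \<forall>x\<in>mspace X. \<forall>y\<in>mspace X. mdist X x y \<le> D) \<or>
         (\<forall>f :: 'g \<Rightarrow> real. continuous_on UNIV f \<and> (\<forall>g h. f (g + h) = f g + f h)
            \<longrightarrow> f = (\<lambda>_. 0))"
    and \<phi>: "\<phi> \<in> Lip X" and x: "x \<in> mspace X"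
  shows "orbit_average m X act \<phi> (act g x) = orbit_average m X act \<phi> x"
proof -
  let ?F = "orbit_average m X act \<phi>"
  note F = orbit_average_lip(1)[OF \<phi>]
  define \<xi> where "\<xi> h = ?F (act h x) - ?F x" for h
  \<comment> \<open>Moving both points by h translates the averaged difference on the right, so its
    mean is unchanged.\<close>
  have shift: "?F (act h y) - ?F (act h x) = ?F y - ?F x" if y: "y \<in> mspace X" for h y
    using inv[OF orbit_diff_LUCB[OF \<phi> y x], of h] x y
    by (simp add: orbit_average_diff[OF \<phi>] act_in act_add)
  \<comment> \<open>By \<open>shift\<close> the increment caused by a is the same at b x as at
    x.\<close>
  have hom: "\<xi> (a + b) = \<xi> a + \<xi> b" for a b
    using shift[of "act b x" a] x by (simp add: \<xi>_def act_in act_add)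
  \<comment> \<open>Up to a constant, \<xi> is the Lipschitz function \<open>?F\<close> along the
    continuous orbit map of x.\<close>
  have "continuous_on UNIV \<xi>"
    unfolding continuous_on_def
  proof (intro ballI tendstoI)
    fix a and e :: real assume "0 < e"
    let ?L = "lip_const X ?F"
    have L: "0 \<le> ?L" by (rule lip_const_nonneg[OF F])
    have d: "0 < e / (?L + 1)" using L \<open>0 < e\<close> by simp
    have "dist (\<xi> h) (\<xi> a) < e" if "mdist X (act h x) (act a x) < e / (?L + 1)" for h
    proof -
      have "dist (\<xi> h) (\<xi> a) \<le> ?L * mdist X (act h x) (act a x)"
        using lip_const_bound[OF F, of "act h x" "act a x"] x
        by (simp add: \<xi>_def dist_real_def act_in)
      also have "\<dots> \<le> (?L + 1) * mdist X (act h x) (act a x)"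
        by (intro mult_right_mono) auto
      also have "\<dots> < e" using that L by (simp add: pos_less_divide_eq mult.commute)
      finally show ?thesis .
    qed
    then have "\<forall>\<^sub>F h in nhds a. dist (\<xi> h) (\<xi> a) < e"
      by (rule eventually_mono[OF eventually_act_dist[OF x d]])
    then show "\<forall>\<^sub>F h in at a. dist (\<xi> h) (\<xi> a) < e"
      by (simp add: eventually_nhds_conv_at)
  qed
  \<comment> \<open>With finite diameter \<xi> is bounded, whereas a nonzero value of a homomorphism
    has unbounded multiples among its values.\<close>
  moreover have "\<xi> = (\<lambda>_. 0)"
    if D: "\<forall>x\<in>mspace X. \<forall>y\<in>mspace X. mdist X x y \<le> D" for D
  proof (rule ext, rule ccontr)
    fix h assume nz: "\<xi> h \<noteq> 0"
    have mult: "\<exists>k. \<xi> k = real n * \<xi> h" for n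
    proof (induction n)
      case 0
      show ?case using x by (intro exI[of _ 0]) (simp add: \<xi>_def act_zero)
    next
      case (Suc n)
      then obtain k where "\<xi> k = real n * \<xi> h" by blast
      then show ?case by (intro exI[of _ "k + h"]) (simp add: hom distrib_right)
    qed
    have bound: "\<bar>\<xi> k\<bar> \<le> lip_const X ?F * D" for k
    proof -
      have "\<bar>\<xi> k\<bar> \<le> lip_const X ?F * mdist X (act k x) x"
        using lip_const_bound[OF F, of "act k x" x] x by (simp add: \<xi>_def act_in)
      also have "\<dots> \<le> lip_const X ?F * D"
        using D x by (intro mult_left_mono lip_const_nonneg[OF F]) (simp add: act_in)
      finally show ?thesis .
    qed
    obtain n where "lip_const X ?F * D < real n * \<bar>\<xi> h\<bar>"
      using reals_Archimedean3[of "\<bar>\<xi> h\<bar>"] nz by auto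
    moreover obtain k where "\<xi> k = real n * \<xi> h" using mult by blast
    ultimately show False using bound[of k] by (simp add: abs_mult)
  qed
  ultimately have "\<xi> = (\<lambda>_. 0)" using alt hom by blast
  then have "\<xi> g = 0" by simp
  then show ?thesis by (simp add: \<xi>_def)
qed

end

section \<open>Descent to the space of orbit closures\<close>

lemma orbit_descend_lip:
  assumes \<phi>: "\<phi> \<in> Lip X" and inv: "\<And>g x. x \<in> mspace X \<Longrightarrow> \<phi> (act g x) = \<phi> x"
  shows "x \<in> mspace X \<Longrightarrow> orbit_descend X act \<phi> (orbit_closure X act x) = \<phi> x"
    and "orbit_descend X act \<phi> \<in> Lip (orbit_space X act)"
    and "lip_const (orbit_space X act) (orbit_descend X act \<phi>) \<le> lip_const X \<phi>"
proof -
  let ?L = "lip_const X \<phi>"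
  have L: "0 \<le> ?L" by (rule lip_const_nonneg[OF \<phi>])
  \<comment> \<open>Since \<phi> (h x) = \<phi> x, the Lipschitz estimate holds with the distance
    from h x to y for every h, hence with the infimum over h.\<close>
  have bound: "\<bar>\<phi> x - \<phi> y\<bar>
      \<le> ?L * mdist (orbit_space X act) (orbit_closure X act x) (orbit_closure X act y)"
    if x: "x \<in> mspace X" and y: "y \<in> mspace X" for x y
    unfolding mdist_orbit_space[OF action x y]
  proof (rule field_le_epsilon)
    fix e :: real assume "0 < e"
    then have e: "0 < e / (?L + 1)" using L by simp
    obtain h where h: "mdist X (act h x) y < (INF h. mdist X (act h x) y) + e / (?L + 1)"
      using orbit_dist_less[OF action x y e] by blast
    have "\<bar>\<phi> x - \<phi> y\<bar> \<le> ?L * mdist X (act h x) y"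
      using lip_const_bound[OF \<phi>, of "act h x" y] x y by (simp add: act_in inv)
    also have "\<dots> \<le> ?L * ((INF h. mdist X (act h x) y) + e / (?L + 1))"
      using h L by (intro mult_left_mono) auto
    also have "\<dots> \<le> ?L * (INF h. mdist X (act h x) y) + e"
      using \<open>0 < e\<close> L by (simp add: field_simps)
    finally show "\<bar>\<phi> x - \<phi> y\<bar> \<le> ?L * (INF h. mdist X (act h x) y) + e" .
  qed
  show descend: "orbit_descend X act \<phi> (orbit_closure X act x) = \<phi> x" if x: "x \<in> mspace X" for x
  proof -
    let ?y = "SOME y. y \<in> mspace X \<and> orbit_closure X act y = orbit_closure X act x"
    have y: "?y \<in> mspace X \<and> orbit_closure X act ?y = orbit_closure X act x"
      by (rule someI[of _ x]) (simp add: x)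
    have "mdist (orbit_space X act) (orbit_closure X act x) (orbit_closure X act x) = 0"
      using x by (intro Metric_space.mdist_zero[OF Metric_space_mspace_mdist])
        (simp add: mspace_orbit_space[OF action])
    \<comment> \<open>Representatives of one orbit closure are at orbit distance 0, so
      \<open>bound\<close> makes the choice by \<open>SOME\<close> irrelevant.\<close>
    then have "\<phi> ?y = \<phi> x" using bound[of ?y x] x y by simp
    then show ?thesis by (simp add: orbit_descend_def)
  qed
  have "\<bar>orbit_descend X act \<phi> A - orbit_descend X act \<phi> B\<bar> \<le> ?L * mdist (orbit_space X act) A B"
    if "A \<in> mspace (orbit_space X act)" "B \<in> mspace (orbit_space X act)" for A B
    using that bound by (auto simp: mspace_orbit_space[OF action] descend)
  then show "orbit_descend X act \<phi> \<in> Lip (orbit_space X act)"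
    "lip_const (orbit_space X act) (orbit_descend X act \<phi>) \<le> ?L"
    using LipI_lip_const L by blast+
qed

end

section \<open>Construction of the operator and its properties\<close>

theorem theorem1p6:
  fixes X :: "'x metric" and act :: "'g::topological_group_add \<Rightarrow> 'x \<Rightarrow> 'x"
  assumes "amenable TYPE('g)" and "skew_amenable TYPE('g)"
    and "continuous_isometric_action X act"
    and "(\<exists>D. \<forall>x\<in>mspace X. \<forall>y\<in>mspace X. mdist X x y \<le> D) \<or>
         (\<forall>f :: 'g \<Rightarrow> real. continuous_on UNIV f \<and> (\<forall>g h. f (g + h) = f g + f h)
            \<longrightarrow> f = (\<lambda>_. 0))"
  shows "\<exists>S. linear_contraction X (orbit_space X act) S \<and>
    (\<forall>g. \<forall>\<phi>\<in>Lip X. S (lip_class X (\<lambda>x. \<phi> (act (- g) x))) = S (lip_class X \<phi>)) \<and>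
    (\<forall>\<phi>\<in>Lip X. (\<forall>g. \<forall>x\<in>mspace X. \<phi> (act g x) = \<phi> x) \<longrightarrow>
       (\<forall>\<psi>\<in>S (lip_class X \<phi>). \<exists>c. \<forall>x\<in>mspace X. \<psi> (orbit_closure X act x) = \<phi> x + c))"
proof -
  note action = assms(3)
  obtain m :: "('g \<Rightarrow> real) \<Rightarrow> real" where m: "is_mean m"
    and skew: "\<And>g \<phi>. \<phi> \<in> LUCB \<Longrightarrow> m (\<lambda>h. \<phi> (- g + h)) = m \<phi>"
    using assms(2) unfolding skew_amenable_def by blast
  obtain m' :: "('g \<Rightarrow> real) \<Rightarrow> real" where m': "is_mean m'"
    and inv: "\<And>g \<phi>. \<phi> \<in> LUCB \<Longrightarrow> m' (\<lambda>h. \<phi> (h + g)) = m' \<phi>"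
    using assms(1) unfolding amenable_def by blast
  let ?T = "orbit_average m X act" and ?T' = "orbit_average m' X act"
  let ?Y = "orbit_space X act"
  note T = orbit_average_lip[OF action m] and T' = orbit_average_lip[OF action m']
  \<comment> \<open>The inner average absorbs translations of \<phi>; the outer one makes the result
    constant on orbits, as descent requires.\<close>
  define R where "R \<phi> = orbit_descend X act (?T' (?T \<phi>))" for \<phi>
  define S where "S A = lip_class ?Y (R (SOME \<phi>. \<phi> \<in> A))" for A
  have const: "?T' (?T \<phi>) (act g x) = ?T' (?T \<phi>) x" if "\<phi> \<in> Lip X" "x \<in> mspace X" for \<phi> g x
    by (rule orbit_average_constant_on_orbits[OF action m' inv assms(4) T(1)[OF that(1)] that(2)])
  have TT: "?T' (?T \<phi>) \<in> Lip X" if "\<phi> \<in> Lip X" for \<phi>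
    by (intro T'(1) T(1) that)
  have R: "R \<phi> (orbit_closure X act x) = ?T' (?T \<phi>) x"
    if \<phi>: "\<phi> \<in> Lip X" and x: "x \<in> mspace X" for \<phi> x
    using orbit_descend_lip(1)[where \<phi> = "?T' (?T \<phi>)" and act = act, OF action TT[OF \<phi>] _ x]
      const[OF \<phi>] unfolding R_def by simp
  have R_Lip: "R \<phi> \<in> Lip ?Y" if \<phi>: "\<phi> \<in> Lip X" for \<phi>
    using orbit_descend_lip(2)[where \<phi> = "?T' (?T \<phi>)" and act = act, OF action TT[OF \<phi>]]
      const[OF \<phi>] unfolding R_def by simp
  have R_const: "lip_const ?Y (R \<phi>) \<le> lip_const X \<phi>" if \<phi>: "\<phi> \<in> Lip X" for \<phi>
  proof -
    have "lip_const ?Y (R \<phi>) \<le> lip_const X (?T' (?T \<phi>))"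
      using orbit_descend_lip(3)[where \<phi> = "?T' (?T \<phi>)" and act = act, OF action TT[OF \<phi>]]
        const[OF \<phi>] unfolding R_def by simp
    also have "\<dots> \<le> lip_const X (?T \<phi>)" by (rule T'(2)[OF T(1)[OF \<phi>]])
    also have "\<dots> \<le> lip_const X \<phi>" by (rule T(2)[OF \<phi>])
    finally show ?thesis .
  qed
  \<comment> \<open>Every point of \<open>?Y\<close> is an orbit closure, so equality of classes can
    be tested on X. Independence of the representative, linearity and invariance are all reduced to
    this.\<close>
  have R_eqI: "lip_class ?Y (R \<psi>) = lip_class ?Y f"
    if "\<psi> \<in> Lip X" "f \<in> Lip ?Y"
      "\<And>x. x \<in> mspace X \<Longrightarrow> ?T' (?T \<psi>) x = f (orbit_closure X act x)" for \<psi> f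
    using that R R_Lip
    by (intro lip_class_eqI[where c = 0]) (auto simp: mspace_orbit_space[OF action])
  have S: "S (lip_class X \<phi>) = lip_class ?Y (R \<phi>)" if \<phi>: "\<phi> \<in> Lip X" for \<phi>
  proof -
    let ?\<psi> = "SOME \<psi>. \<psi> \<in> lip_class X \<phi>"
    have "?\<psi> \<in> lip_class X \<phi>" by (rule someI[of _ \<phi>]) (rule lip_class_self[OF \<phi>])
    then obtain c where \<psi>: "?\<psi> \<in> Lip X" and c: "\<And>x. x \<in> mspace X \<Longrightarrow> ?\<psi> x = \<phi> x + c"
      unfolding mem_lip_class by blast
    \<comment> \<open>The constant \<open>c\<close> is already lost in the first average. The
      summand 0 gives the equation the shape that \<open>orbit_average_cong\<close> expects for the
      second; the same device recurs below.\<close>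
    have 1: "?T ?\<psi> x = ?T \<phi> x + 0" if "x \<in> mspace X" for x
      using orbit_average_cong[OF action m c that] by simp
    have "?T' (?T ?\<psi>) x = ?T' (?T \<phi>) x" if "x \<in> mspace X" for x
      by (rule orbit_average_cong[OF action m' 1 that])
    then show ?thesis unfolding S_def
      using R[OF \<phi>] by (intro R_eqI[OF \<psi> R_Lip[OF \<phi>]]) simp
  qed
  have S_add: "S (LIP_add X (lip_class X \<phi>) (lip_class X \<psi>))
      = LIP_add ?Y (S (lip_class X \<phi>)) (S (lip_class X \<psi>))"
    if \<phi>: "\<phi> \<in> Lip X" and \<psi>: "\<psi> \<in> Lip X" for \<phi> \<psi>
  proof -
    have 1: "?T (\<lambda>x. \<phi> x + \<psi> x) x = (?T \<phi> x + ?T \<psi> x) + 0" if "x \<in> mspace X" for x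
      using orbit_average_add[OF action m \<phi> \<psi> that] by simp
    have "?T' (?T (\<lambda>x. \<phi> x + \<psi> x)) x = R \<phi> (orbit_closure X act x) + R \<psi> (orbit_closure X act x)"
      if "x \<in> mspace X" for x
      using orbit_average_cong[OF action m' 1 that]
        orbit_average_add[OF action m' T(1)[OF \<phi>] T(1)[OF \<psi>] that] R \<phi> \<psi> that by simp
    then have "lip_class ?Y (R (\<lambda>x. \<phi> x + \<psi> x)) = lip_class ?Y (\<lambda>A. R \<phi> A + R \<psi> A)"
      by (intro R_eqI Lip_add R_Lip \<phi> \<psi>)
    then show ?thesis
      using \<phi> \<psi> by (simp add: S Lip_add R_Lip LIP_add_class)
  qed
  have S_scale: "S (LIP_scale X c (lip_class X \<phi>)) = LIP_scale ?Y c (S (lip_class X \<phi>))"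
    if \<phi>: "\<phi> \<in> Lip X" for c \<phi>
  proof -
    have 1: "?T (\<lambda>x. c * \<phi> x) x = c * ?T \<phi> x + 0" if "x \<in> mspace X" for x
      using orbit_average_scale[OF action m \<phi> that] by simp
    have "?T' (?T (\<lambda>x. c * \<phi> x)) x = c * R \<phi> (orbit_closure X act x)" if "x \<in> mspace X" for x
      using orbit_average_cong[OF action m' 1 that]
        orbit_average_scale[OF action m' T(1)[OF \<phi>] that] R \<phi> that by simp
    then have "lip_class ?Y (R (\<lambda>x. c * \<phi> x)) = lip_class ?Y (\<lambda>A. c * R \<phi> A)"
      by (intro R_eqI Lip_scale R_Lip \<phi>)
    then show ?thesis
      using \<phi> by (simp add: S Lip_scale R_Lip LIP_scale_class)
  qed
  have "linear_contraction X ?Y S"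
    unfolding linear_contraction_def LIP_eq
    using S_add S_scale R_const by (auto simp: S R_Lip LIP_norm_class)
  moreover have "S (lip_class X (\<lambda>x. \<phi> (act (- g) x))) = S (lip_class X \<phi>)"
    if \<phi>: "\<phi> \<in> Lip X" for g \<phi>
  proof -
    note \<phi>g = Lip_translate[OF action \<phi>, of "- g"]
    have 1: "?T (\<lambda>x. \<phi> (act (- g) x)) x = ?T \<phi> x + 0" if "x \<in> mspace X" for x
      using orbit_average_skew[OF action m skew \<phi> that] by simp
    have "?T' (?T (\<lambda>x. \<phi> (act (- g) x))) x = R \<phi> (orbit_closure X act x)"
      if "x \<in> mspace X" for x
      using orbit_average_cong[OF action m' 1 that] R[OF \<phi> that] by simp
    then show ?thesis
      unfolding S[OF \<phi>] S[OF \<phi>g] by (intro R_eqI R_Lip \<phi> \<phi>g)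
  qed
  moreover have "\<exists>c. \<forall>x\<in>mspace X. \<psi> (orbit_closure X act x) = \<phi> x + c"
    if \<phi>: "\<phi> \<in> Lip X" and orb: "\<And>g x. x \<in> mspace X \<Longrightarrow> \<phi> (act g x) = \<phi> x"
      and \<psi>: "\<psi> \<in> S (lip_class X \<phi>)" for \<phi> \<psi>
  proof -
    obtain c where c: "\<And>A. A \<in> mspace ?Y \<Longrightarrow> \<psi> A = R \<phi> A + c"
      using \<psi> unfolding S[OF \<phi>] mem_lip_class by blast
    \<comment> \<open>For \<phi> constant on orbits the first average subtracts \<phi> (base X). The
      second is blind to that constant and subtracts \<phi> (base X) from \<phi> itself, so the
      value is subtracted once in total.\<close>
    have 1: "?T \<phi> x = \<phi> x + (- \<phi> (base X))" if "x \<in> mspace X" for x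
      using orbit_average_invariant[where \<phi> = \<phi>, OF action m orb that] by simp
    have "\<psi> (orbit_closure X act x) = \<phi> x + (c - \<phi> (base X))" if x: "x \<in> mspace X" for x
      using c[of "orbit_closure X act x"] x R[OF \<phi> x]
        orbit_average_cong[OF action m' 1 x]
        orbit_average_invariant[where \<phi> = \<phi>, OF action m' orb x]
      by (simp add: mspace_orbit_space[OF action])
    then show ?thesis by blast
  qed
  ultimately show ?thesis by blast
qed

end
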